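(* Suppose $C_{m,n}$ is a complete intersection. Then, for $p\in\mathbb C^{mn}$, the critical ideal for computing $\beta\mathrm{EDdegree}(C_{m,n})$ is given, after introducing Lagrange multipliers $\lambda=(\lambda_1,\dots,\lambda_m)$, $\lambda_i=(\lambda_{i1},\dots,\lambda_{ir})$, as additional variables, by $$\Big(I_{C_{m,n}}+\Big\langle \sum_{i=1}^m\lambda_i\nabla f_\beta(x_i)-\big((p,0)-(x,0)\big)\Big\rangle\Big):\big((I_{C_{m,n}})_{sing}\big)^\infty ,$$ that is, the critical ideal in $\mathbb C[x,\beta]$ is obtained from this ideal of $\mathbb C[x,\beta,\lambda]$ by eliminating $\lambda$.
   Context: Let $f_\beta=(f_{\beta,1},\dots,f_{\beta,r})\colon\mathbb C^n\to\mathbb C^r$ be a system of polynomials whose coefficients are polynomials in $\beta\in\mathbb C^k$. The incidence variety is $$C_{m,n}=\{(x,\beta)\in\mathbb C^{mn}\times\mathbb C^k\mid f_\beta(x_i)=0,\ 1\le i\le m\}\subseteq\mathbb C^{mn+k},\qquad x=(x_1,\dots,x_m)\in(\mathbb C^n)^m,$$ with projections $\pi(x,\beta)=x$ and $\tau(x,\beta)=\beta$; $\mathcal H_{m,n}$ is the Zariski closure of $\pi(C_{m,n})$. Standing assumption: $C_{m,n}$ has a component dominating both $\pi$ (onto $\mathcal H_{m,n}$) and $\tau$, and $C_{m,n}$ has only this one component and is irreducible. $I_{C_{m,n}}$ is the ideal generated by the $mr$ polynomials $f_{\beta,j}(x_i)$ and $J(C_{m,n})$ is their Jacobian matrix with respect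 to $(x,\beta)$. $C_{m,n}$ being a complete intersection means that it has codimension $mr$ in $\mathbb C^{mn+k}$. The critical ideal for computing $\beta\mathrm{EDdegree}(C_{m,n})$ is, with $c$ the codimension of $C_{m,n}$, $$\Big(I_{C_{m,n}}+\Big\langle (c+1)\times(c+1)\text{-minors of }\begin{pmatrix}(p,0)-(x,0)\\ J(C_{m,n})\end{pmatrix}\Big\rangle\Big):((I_{C_{m,n}})_{sing})^\infty\subseteq\mathbb C[x,\beta],$$ where $(I_{C_{m,n}})_{sing}=I_{C_{m,n}}+\langle c\times c\text{-minors of }J(C_{m,n})\rangle$; $\beta\mathrm{EDdegree}(C_{m,n})$ is its degree for generic $p\in\mathbb C^{mn}$. In the claim, $\lambda_i\nabla f_\beta(x_i)=\sum_{j=1}^r\lambda_{ij}\nabla f_{\beta,j}(x_i)$, where $\nabla$ is the gradient in $\mathbb C^{mn+k}$ with respect to all variables $(x,\beta)$ (the corresponding row of $J(C_{m,n})$); the angle brackets denote the ideal generated by the $mn+k$ coordinates of the vector, with coordinates ordered as $(x,\beta)$. $I_{C_{m,n}}$ and $(I_{C_{m,n}})_{sing}$ are extended to $\mathbb C[x,\beta,\lambda]$. *)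

theory Defs
  imports "HOL-Library.Poly_Mapping" "HOL-Library.Set_Algebras" "HOL-Library.Cardinality"
    "Jordan_Normal_Form.Determinant"
begin

section \<open>Multivariate polynomials over the complex numbers\<close>

text \<open>
  \<open>'v mpoly\<close> is the polynomial ring over the complex numbers in the variables \<open>'v\<close>:
  a monomial is a finitely supported exponent vector, a polynomial a finitely supported family of
  coefficients. Multiplication and the ring structure are those of \<^theory>\<open>HOL-Library.Poly_Mapping\<close>.
\<close>

type_synonym 'v mpoly = "('v \<Rightarrow>\<^sub>0 nat) \<Rightarrow>\<^sub>0 complex"

definition Const :: "complex \<Rightarrow> 'v mpoly" where
  "Const c = Poly_Mapping.single 0 c"

definition Var :: "'v \<Rightarrow> 'v mpoly" where
  "Var v = Poly_Mapping.single (Poly_Mapping.single v 1) 1"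

definition mp_eval :: "('v \<Rightarrow> complex) \<Rightarrow> 'v mpoly \<Rightarrow> complex" where
  "mp_eval a q = (\<Sum>t\<in>Poly_Mapping.keys q.
     Poly_Mapping.lookup q t * (\<Prod>v\<in>Poly_Mapping.keys t. a v ^ Poly_Mapping.lookup t v))"

definition mp_subst :: "('v \<Rightarrow> 'w mpoly) \<Rightarrow> 'v mpoly \<Rightarrow> 'w mpoly" where
  "mp_subst \<sigma> q = (\<Sum>t\<in>Poly_Mapping.keys q.
     Const (Poly_Mapping.lookup q t) * (\<Prod>v\<in>Poly_Mapping.keys t. \<sigma> v ^ Poly_Mapping.lookup t v))"

text \<open>
  Formal partial derivative. The exponent subtraction is truncated, but it only truncates where the
  coefficient is zero.
\<close>

definition mp_pderiv :: "'v \<Rightarrow> 'v mpoly \<Rightarrow> 'v mpoly" where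
  "mp_pderiv v q = (\<Sum>t\<in>Poly_Mapping.keys q.
     Poly_Mapping.single (t - Poly_Mapping.single v 1)
       (Poly_Mapping.lookup q t * of_nat (Poly_Mapping.lookup t v)))"

section \<open>Ideals of a commutative ring\<close>

text \<open>
  The ideal generated by \<open>S\<close> is the linear span of \<open>S\<close> in the ring viewed as a module over itself.
  The sum of two ideals is their elementwise sum from \<^theory>\<open>HOL-Library.Set_Algebras\<close>.
\<close>

lemma ring_module: "Modules.module ((*) :: 'a::comm_ring_1 \<Rightarrow> 'a \<Rightarrow> 'a)"
  by unfold_locales (simp_all add: algebra_simps)

definition ideal_gen :: "'a::comm_ring_1 set \<Rightarrow> 'a set" where
  "ideal_gen S = Modules.module.span (*) S"

definition ideal_mult :: "'a::comm_ring_1 set \<Rightarrow> 'a set \<Rightarrow> 'a set" where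
  "ideal_mult I J = ideal_gen {a * b | a b. a \<in> I \<and> b \<in> J}"

primrec ideal_power :: "'a::comm_ring_1 set \<Rightarrow> nat \<Rightarrow> 'a set" where
  "ideal_power J 0 = UNIV"
| "ideal_power J (Suc N) = ideal_mult J (ideal_power J N)"

definition ideal_quotient :: "'a::comm_ring_1 set \<Rightarrow> 'a set \<Rightarrow> 'a set" where
  "ideal_quotient I J = {g. \<forall>h\<in>J. g * h \<in> I}"

definition saturation :: "'a::comm_ring_1 set \<Rightarrow> 'a set \<Rightarrow> 'a set" where
  "saturation I J = (\<Union>N. ideal_quotient I (ideal_power J N))"

text \<open>
  The \<open>s\<close>-by-\<open>s\<close> minors of a matrix given as a function of a row and a column index. The selected
  rows and columns are listed in every order, so each minor occurs with both signs; this does not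
  affect the ideal generated by the minors. There are none if \<open>s\<close> exceeds the number of rows or
  columns.
\<close>

definition minors :: "nat \<Rightarrow> ('i \<Rightarrow> 'j \<Rightarrow> 'a::comm_ring_1) \<Rightarrow> 'a set" where
  "minors s A = {det (mat s s (\<lambda>(a, b). A (rs ! a) (cs ! b))) | rs cs.
     distinct rs \<and> length rs = s \<and> distinct cs \<and> length cs = s}"

section \<open>Affine varieties\<close>

definition zariski_closed :: "('v \<Rightarrow> complex) set \<Rightarrow> bool" where
  "zariski_closed V \<longleftrightarrow> (\<exists>S :: 'v mpoly set. V = {a. \<forall>q\<in>S. mp_eval a q = 0})"

definition zariski_closure :: "('v \<Rightarrow> complex) set \<Rightarrow> ('v \<Rightarrow> complex) set" where
  "zariski_closure A = zariski_closed hull A"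

definition zariski_irreducible :: "('v \<Rightarrow> complex) set \<Rightarrow> bool" where
  "zariski_irreducible V \<longleftrightarrow> V \<noteq> {} \<and>
     (\<forall>A B. zariski_closed A \<and> zariski_closed B \<and> V \<subseteq> A \<union> B \<longrightarrow> V \<subseteq> A \<or> V \<subseteq> B)"

definition dominates :: "('a \<Rightarrow> ('v \<Rightarrow> complex)) \<Rightarrow> 'a set \<Rightarrow> ('v \<Rightarrow> complex) set \<Rightarrow> bool" where
  "dominates \<phi> V W \<longleftrightarrow> zariski_closure (\<phi> ` V) = W"

text \<open>
  Krull dimension of a nonempty closed set. The lengths of chains are bounded by the number of
  variables when \<open>'v\<close> is finite, so the supremum is a maximum and the subtraction in the
  codimension does not truncate.
\<close>

definition zariski_dim :: "('v::finite \<Rightarrow> complex) set \<Rightarrow> nat" where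
  "zariski_dim V = Sup {d. \<exists>Z :: nat \<Rightarrow> ('v \<Rightarrow> complex) set.
     (\<forall>i\<le>d. zariski_closed (Z i) \<and> zariski_irreducible (Z i) \<and> Z i \<subseteq> V) \<and>
     (\<forall>i<d. Z i \<subset> Z (Suc i))}"

definition zariski_codim :: "('v::finite \<Rightarrow> complex) set \<Rightarrow> nat" where
  "zariski_codim V = CARD('v) - zariski_dim V"

section \<open>The incidence variety and its ideals\<close>

text \<open>
  The index types \<open>'m\<close>, \<open>'n\<close>, \<open>'k\<close>, \<open>'r\<close> have $m$, $n$, $k$, $r$ elements. A system is a family
  \<open>f :: 'r \<Rightarrow> ('n + 'k) mpoly\<close>: \<open>Inl a\<close> is the \<open>a\<close>-th coordinate on $\mathbb C^n$ and \<open>Inr b\<close> the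
  parameter $\beta_b$. The ring $\mathbb C[x,\beta]$ has the variables \<open>('m \<times> 'n) + 'k\<close>, where
  \<open>Inl (i, a)\<close> is the \<open>a\<close>-th coordinate of $x_i$.
\<close>

definition f_at :: "('r \<Rightarrow> ('n + 'k) mpoly) \<Rightarrow> 'm \<Rightarrow> 'r \<Rightarrow> (('m \<times> 'n) + 'k) mpoly" where
  "f_at f i j = mp_subst (case_sum (\<lambda>a. Var (Inl (i, a))) (\<lambda>b. Var (Inr b))) (f j)"

definition incidence_variety ::
    "('r \<Rightarrow> ('n + 'k) mpoly) \<Rightarrow> (('m \<times> 'n) + 'k \<Rightarrow> complex) set" where
  "incidence_variety f =
     {z. \<forall>i j. mp_eval (case_sum (\<lambda>a. z (Inl (i, a))) (\<lambda>b. z (Inr b))) (f j) = 0}"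

definition proj_x :: "(('m \<times> 'n) + 'k \<Rightarrow> complex) \<Rightarrow> ('m \<times> 'n \<Rightarrow> complex)" where
  "proj_x z = (\<lambda>u. z (Inl u))"

definition proj_beta :: "(('m \<times> 'n) + 'k \<Rightarrow> complex) \<Rightarrow> ('k \<Rightarrow> complex)" where
  "proj_beta z = (\<lambda>b. z (Inr b))"

definition incidence_ideal :: "('r \<Rightarrow> ('n + 'k) mpoly) \<Rightarrow> (('m \<times> 'n) + 'k) mpoly set" where
  "incidence_ideal f = ideal_gen {f_at f i j | i j. True}"

definition jacobian ::
    "('r \<Rightarrow> ('n + 'k) mpoly) \<Rightarrow> 'm \<times> 'r \<Rightarrow> ('m \<times> 'n) + 'k \<Rightarrow> (('m \<times> 'n) + 'k) mpoly" where
  "jacobian f = (\<lambda>(i, j) v. mp_pderiv v (f_at f i j))"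

text \<open>The vector $(p,0)-(x,0)$.\<close>

definition distance_vector ::
    "('m \<times> 'n \<Rightarrow> complex) \<Rightarrow> ('m \<times> 'n) + 'k \<Rightarrow> (('m \<times> 'n) + 'k) mpoly" where
  "distance_vector p v = (case v of Inl u \<Rightarrow> Const (p u) - Var (Inl u) | Inr b \<Rightarrow> 0)"

text \<open>Row \<open>None\<close> is the row placed above the Jacobian matrix.\<close>

definition augmented_jacobian ::
    "('r \<Rightarrow> ('n + 'k) mpoly) \<Rightarrow> ('m \<times> 'n \<Rightarrow> complex) \<Rightarrow>
     ('m \<times> 'r) option \<Rightarrow> ('m \<times> 'n) + 'k \<Rightarrow> (('m \<times> 'n) + 'k) mpoly" where
  "augmented_jacobian f p e = (case e of None \<Rightarrow> distance_vector p | Some l \<Rightarrow> jacobian f l)"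

definition incidence_codim ::
    "'m::finite itself \<Rightarrow> ('r \<Rightarrow> ('n::finite + 'k::finite) mpoly) \<Rightarrow> nat" where
  "incidence_codim _ f =
     zariski_codim (incidence_variety f :: (('m \<times> 'n) + 'k \<Rightarrow> complex) set)"

definition singular_ideal ::
    "('r \<Rightarrow> ('n::finite + 'k::finite) mpoly) \<Rightarrow> (('m::finite \<times> 'n) + 'k) mpoly set" where
  "singular_ideal f = incidence_ideal f +
     ideal_gen (minors (incidence_codim TYPE('m) f)
       (jacobian f :: 'm \<times> 'r \<Rightarrow> ('m \<times> 'n) + 'k \<Rightarrow> (('m \<times> 'n) + 'k) mpoly))"

definition critical_ideal ::
    "('r \<Rightarrow> ('n::finite + 'k::finite) mpoly) \<Rightarrow> ('m::finite \<times> 'n \<Rightarrow> complex) \<Rightarrow>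
     (('m \<times> 'n) + 'k) mpoly set" where
  "critical_ideal f p =
     saturation
       (incidence_ideal f +
        ideal_gen (minors (incidence_codim TYPE('m) f + 1) (augmented_jacobian f p)))
       (singular_ideal f)"

section \<open>Lagrange multipliers\<close>

text \<open>
  $\mathbb C[x,\beta,\lambda]$ has the additional variables \<open>Inr (i, j)\<close>, standing for
  $\lambda_{ij}$. The map \<open>incl\<close> is the inclusion of $\mathbb C[x,\beta]$.
\<close>

definition incl :: "'v mpoly \<Rightarrow> ('v + 'l) mpoly" where
  "incl q = mp_subst (\<lambda>v. Var (Inl v)) q"

definition extend_ideal :: "'v mpoly set \<Rightarrow> ('v + 'l) mpoly set" where
  "extend_ideal I = ideal_gen (incl ` I)"

definition eliminate :: "('v + 'l) mpoly set \<Rightarrow> 'v mpoly set" where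
  "eliminate I = {q. incl q \<in> I}"

definition lagrange_vector ::
    "('r::finite \<Rightarrow> ('n + 'k) mpoly) \<Rightarrow> ('m::finite \<times> 'n \<Rightarrow> complex) \<Rightarrow>
     ('m \<times> 'n) + 'k \<Rightarrow> ((('m \<times> 'n) + 'k) + ('m \<times> 'r)) mpoly" where
  "lagrange_vector f p v =
     (\<Sum>i\<in>UNIV. \<Sum>j\<in>UNIV. Var (Inr (i, j)) * incl (jacobian f (i, j) v)) -
     incl (distance_vector p v)"

definition lagrange_ideal ::
    "('r::finite \<Rightarrow> ('n::finite + 'k::finite) mpoly) \<Rightarrow> ('m::finite \<times> 'n \<Rightarrow> complex) \<Rightarrow>
     ((('m \<times> 'n) + 'k) + ('m \<times> 'r)) mpoly set" where
  "lagrange_ideal f p =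
     saturation
       (extend_ideal (incidence_ideal f) + ideal_gen (range (lagrange_vector f p)))
       (extend_ideal (singular_ideal f))"

end

theory Submission
  imports Defs
begin

text \<open>
  The theorem is a fact of linear algebra over an arbitrary commutative ring \<open>R\<close>. The geometry enters
  through the codimension: for a complete intersection the size \<open>c\<close> of the minors is the number
  \<open>mr\<close> of rows of the Jacobian matrix \<open>J\<close>. So the \<open>c\<close>-minors use all rows of \<open>J\<close>, and
  the \<open>(c + 1)\<close>-minors use all rows of \<open>J\<close> together with the additional row \<open>d = (p,0) - (x,0)\<close>.
  Let \<open>Q\<close> be the ideal in \<open>R\<close> generated by \<open>I\<close> and the \<open>(c + 1)\<close>-minors, and \<open>E\<close> the Lagrange ideal
  in \<open>R[\<lambda>]\<close> generated by \<open>I\<close> and the entries of \<open>\<lambda>J - d\<close>; both are taken before saturation.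

  Every critical polynomial is in the elimination ideal because \<open>Q \<subseteq> E\<close>: modulo \<open>E\<close> the row \<open>d\<close> is
  the combination \<open>\<lambda>J\<close> of the other rows, so the \<open>(c + 1)\<close>-minors vanish (\<open>det_in_lagrange_ideal\<close>).

  Conversely, let \<open>D\<close> be a \<open>c\<close>-minor. Where \<open>D\<close> is invertible, the multipliers are determined:
  Laplace expansion of the \<open>(c + 1)\<close>-minors that extend \<open>D\<close> by one column gives elements \<open>a\<close> of \<open>R\<close>,
  the same for each column, with \<open>aJ - Dd\<close> in \<open>Q\<close> (\<open>minor_times_row_combination\<close>). Substituting
  \<open>\<lambda> = a/D\<close> in a membership \<open>g D\<^sup>N \<in> E\<close> and clearing denominators gives \<open>g D\<^bsup>N+K\<^esup> \<in> Q\<close>. To work in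
  \<open>R\<close> itself, with no localization at the possibly non-regular element \<open>D\<close>, the substitution is done
  in two steps: the ring homomorphism \<open>\<lambda> \<mapsto> a s\<close> to \<open>R[s]\<close>, and the additive map
  \<open>q \<mapsto> D\<^sup>K q(1/D)\<close>, which is compatible with ideals for large \<open>K\<close> (\<open>is_ideal_cleared_eval\<close>).
  There are finitely many minors \<open>D\<close>, so powers of each of them suffice for the saturation
  (\<open>mem_saturation_iff\<close>).
\<close>

section \<open>Ideals, their powers and saturations\<close>

abbreviation is_ideal :: "'a::comm_ring_1 set \<Rightarrow> bool" where
  "is_ideal \<equiv> Modules.module.subspace (*)"

lemmas is_idealI = Modules.module.subspaceI[OF ring_module]
lemmas is_ideal_zero = Modules.module.subspace_0[OF ring_module]
lemmas is_ideal_add = Modules.module.subspace_add[OF ring_module]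
lemmas is_ideal_mult = Modules.module.subspace_scale[OF ring_module]
lemmas is_ideal_neg = Modules.module.subspace_neg[OF ring_module]
lemmas is_ideal_sum = Modules.module.subspace_sum[OF ring_module]

lemma is_ideal_mult_right: "is_ideal Q \<Longrightarrow> x \<in> Q \<Longrightarrow> x * c \<in> Q"
  using is_ideal_mult[of Q x c] by (simp add: mult.commute)

lemma is_ideal_gen: "is_ideal (ideal_gen S)"
  unfolding ideal_gen_def by (rule Modules.module.subspace_span[OF ring_module])

lemma ideal_gen_base: "x \<in> S \<Longrightarrow> x \<in> ideal_gen S"
  unfolding ideal_gen_def by (rule Modules.module.span_base[OF ring_module])

lemma ideal_gen_least: "S \<subseteq> Q \<Longrightarrow> is_ideal Q \<Longrightarrow> ideal_gen S \<subseteq> Q"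
  unfolding ideal_gen_def by (rule Modules.module.span_minimal[OF ring_module])

lemma is_ideal_plus:
  assumes "is_ideal A" "is_ideal B"
  shows "is_ideal (A + B)"
proof (rule is_idealI)
  show "0 \<in> A + B"
    using set_plus_intro[OF assms[THEN is_ideal_zero]] by simp
  show "x + y \<in> A + B" if "x \<in> A + B" "y \<in> A + B" for x y
  proof -
    from that obtain a b a' b' where "x = a + b" "y = a' + b'" "a \<in> A" "b \<in> B" "a' \<in> A" "b' \<in> B"
      by (auto elim!: set_plus_elim)
    then have "x + y = (a + a') + (b + b')" "a + a' \<in> A" "b + b' \<in> B"
      using assms by (simp_all add: is_ideal_add)
    then show ?thesis by (metis set_plus_intro)
  qed
  show "c * x \<in> A + B" if "x \<in> A + B" for c x
    using that is_ideal_mult[OF assms(1)] is_ideal_mult[OF assms(2)]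
    by (metis distrib_left set_plus_elim set_plus_intro)
qed

lemma subset_plus_left: "is_ideal B \<Longrightarrow> A \<subseteq> A + B"
  by (metis add.right_neutral is_ideal_zero set_plus_intro subsetI)

lemma subset_plus_right: "is_ideal A \<Longrightarrow> B \<subseteq> A + B"
  by (metis add.left_neutral is_ideal_zero set_plus_intro subsetI)

lemma plus_least: "A \<subseteq> Q \<Longrightarrow> B \<subseteq> Q \<Longrightarrow> is_ideal Q \<Longrightarrow> A + B \<subseteq> Q"
  by (auto elim!: set_plus_elim intro: is_ideal_add)

lemma is_ideal_colon: "is_ideal Q \<Longrightarrow> is_ideal {x. g * x \<in> Q}"
  by (rule is_idealI)
    (auto simp: is_ideal_zero distrib_left is_ideal_add mult.left_commute is_ideal_mult)

lemma is_ideal_vimage: "comm_ring_hom \<phi> \<Longrightarrow> is_ideal Q \<Longrightarrow> is_ideal {x. \<phi> x \<in> Q}"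
proof -
  assume "comm_ring_hom \<phi>" and Q: "is_ideal Q"
  then interpret comm_ring_hom \<phi> by simp
  show ?thesis
    by (rule is_idealI) (auto simp: Q is_ideal_zero hom_distribs is_ideal_add is_ideal_mult)
qed

lemma power_in_ideal_power: "a \<in> J \<Longrightarrow> a ^ N \<in> ideal_power J N"
  by (induction N) (auto simp: ideal_mult_def intro!: ideal_gen_base)

text \<open>
  The extension of a power contains the power of the extension, because both are spanned by images
  of products of elements of \<open>S\<close>. It transports saturations along \<open>\<phi>\<close>.
\<close>

lemma power_extension_subset:
  assumes "comm_ring_hom \<phi>"
  shows "ideal_power (ideal_gen (\<phi> ` S)) N \<subseteq> ideal_gen (\<phi> ` ideal_power S N)"
proof (induction N)
  case 0
  interpret comm_ring_hom \<phi> by fact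
  have "1 \<in> ideal_gen (range \<phi>)"
    by (rule ideal_gen_base) (metis hom_one rangeI)
  then have "x * 1 \<in> ideal_gen (range \<phi>)" for x
    using is_ideal_gen is_ideal_mult by blast
  then show ?case by auto
next
  case (Suc N)
  interpret comm_ring_hom \<phi> by fact
  let ?E = "ideal_gen (\<phi> ` ideal_power S (Suc N))"
  have 1: "\<phi> a * b \<in> ?E" if a: "a \<in> S" and b: "b \<in> ideal_gen (\<phi> ` ideal_power S N)" for a b
  proof -
    have "\<phi> ` ideal_power S N \<subseteq> {b. \<phi> a * b \<in> ?E}"
      using a by (auto simp: hom_mult[symmetric] ideal_mult_def intro!: ideal_gen_base imageI; blast)
    from ideal_gen_least[OF this is_ideal_colon[OF is_ideal_gen]] b show ?thesis by blast
  qed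
  have "a * b \<in> ?E" if a: "a \<in> ideal_gen (\<phi> ` S)" and b: "b \<in> ideal_gen (\<phi> ` ideal_power S N)"
    for a b
  proof -
    have "\<phi> ` S \<subseteq> {a. b * a \<in> ?E}"
      using 1[OF _ b] by (auto simp: mult.commute)
    from ideal_gen_least[OF this is_ideal_colon[OF is_ideal_gen]] a show ?thesis
      by (auto simp: mult.commute)
  qed
  then have "{a * b |a b. a \<in> ideal_gen (\<phi> ` S) \<and> b \<in> ideal_power (ideal_gen (\<phi> ` S)) N} \<subseteq> ?E"
    using Suc by blast
  then show ?case
    unfolding ideal_power.simps(2)[of "ideal_gen _"] ideal_mult_def[of "ideal_gen _"]
    by (rule ideal_gen_least[OF _ is_ideal_gen])
qed

text \<open>
  The pigeonhole principle: a product of more than \<open>\<Sum>K D\<close> generators contains either an element of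
  \<open>I\<close> or some \<open>D\<close> at least \<open>K D\<close> times. The exponents \<open>e\<close> count the generators that the
  induction on \<open>N\<close> has already split off.
\<close>

lemma ideal_power_colon:
  fixes Q I G :: "'a::comm_ring_1 set"
  assumes Q: "is_ideal Q" and IQ: "I \<subseteq> Q" and fin: "finite G"
    and K: "\<And>D. D \<in> G \<Longrightarrow> g * D ^ K D \<in> Q"
    and h: "h \<in> ideal_power (I + ideal_gen G) N"
    and N: "sum K G < N + sum e G"
  shows "g * (\<Prod>D\<in>G. D ^ e D) * h \<in> Q"
  using h N
proof (induction N arbitrary: h e)
  case 0
  then obtain D where D: "D \<in> G" "K D \<le> e D"
    by (metis add_0 leD linorder_le_cases sum_mono)
  have "(\<Prod>D\<in>G. D ^ e D) = D ^ K D * (D ^ (e D - K D) * (\<Prod>D\<in>G - {D}. D ^ e D))"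
    using D by (simp add: prod.remove[OF fin D(1)] mult.assoc[symmetric] power_add[symmetric])
  then have "g * (\<Prod>D\<in>G. D ^ e D) * h =
      g * D ^ K D * (D ^ (e D - K D) * (\<Prod>D\<in>G - {D}. D ^ e D) * h)"
    by (simp add: mult_ac)
  then show ?case
    using is_ideal_mult_right[OF Q K[OF D(1)]] by simp
next
  case (Suc N)
  let ?P = "\<Prod>D\<in>G. D ^ e D"
  let ?S = "I + ideal_gen G"
  have prod: "g * ?P * (a * b) \<in> Q" if a: "a \<in> ?S" and b: "b \<in> ideal_power ?S N" for a b
  proof -
    have "I \<subseteq> {a. g * ?P * b * a \<in> Q}"
      using IQ is_ideal_mult[OF Q] by blast
    moreover have "g * ?P * b * D \<in> Q" if D: "D \<in> G" for D
    proof -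
      let ?e = "e(D := Suc (e D))"
      have "(\<Prod>D\<in>G. D ^ ?e D) = D * ?P"
        by (simp add: prod.remove[OF fin D] mult_ac)
      moreover have "sum ?e G = Suc (sum e G)"
        by (simp add: sum.remove[OF fin D])
      ultimately show ?thesis
        using Suc.IH[OF b, of ?e] Suc.prems(2) by (simp add: mult_ac)
    qed
    then have "ideal_gen G \<subseteq> {a. g * ?P * b * a \<in> Q}"
      by (intro ideal_gen_least is_ideal_colon Q) auto
    ultimately have "?S \<subseteq> {a. g * ?P * b * a \<in> Q}"
      by (intro plus_least is_ideal_colon Q)
    with a show ?thesis by (auto simp: mult_ac)
  qed
  have "ideal_power ?S (Suc N) \<subseteq> {h. g * ?P * h \<in> Q}"
    unfolding ideal_power.simps ideal_mult_def
    by (intro ideal_gen_least is_ideal_colon Q) (use prod in auto)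
  with Suc.prems(1) show ?case by blast
qed

text \<open>
  As \<open>Q\<close> contains \<open>I\<close> and \<open>G\<close> is finite, the saturation can be tested on one generator at a time.
\<close>

lemma mem_saturation_iff:
  assumes Q: "is_ideal Q" and IQ: "I \<subseteq> Q" and fin: "finite G"
    and I: "is_ideal I"
  shows "g \<in> saturation Q (I + ideal_gen G) \<longleftrightarrow> (\<forall>D\<in>G. \<exists>N. g * D ^ N \<in> Q)"
proof
  assume "g \<in> saturation Q (I + ideal_gen G)"
  moreover have "D \<in> I + ideal_gen G" if "D \<in> G" for D
    using subset_plus_right[OF I] ideal_gen_base[OF that] by blast
  ultimately show "\<forall>D\<in>G. \<exists>N. g * D ^ N \<in> Q"
    unfolding saturation_def ideal_quotient_def using power_in_ideal_power by fastforce
next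
  assume "\<forall>D\<in>G. \<exists>N. g * D ^ N \<in> Q"
  then obtain K where K: "\<And>D. D \<in> G \<Longrightarrow> g * D ^ K D \<in> Q" by metis
  have "g * h \<in> Q" if "h \<in> ideal_power (I + ideal_gen G) (Suc (sum K G))" for h
    using ideal_power_colon[OF Q IQ fin K that, of "\<lambda>_. 0"] by simp
  then show "g \<in> saturation Q (I + ideal_gen G)"
    unfolding saturation_def ideal_quotient_def by blast
qed

section \<open>Clearing the denominators of a polynomial at 1/D\<close>

text \<open>
  For \<open>K \<ge> degree q\<close> this is \<open>D\<^sup>K q(1/D)\<close>, written so that it makes sense when \<open>D\<close> is not
  invertible. For smaller \<open>K\<close> the higher coefficients of \<open>q\<close> are dropped, which keeps the map
  additive; such \<open>K\<close> are excluded below by asking for all large \<open>K\<close>.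
\<close>

definition cleared_eval :: "'a::comm_ring_1 \<Rightarrow> nat \<Rightarrow> 'a poly \<Rightarrow> 'a" where
  "cleared_eval D K q = (\<Sum>i\<le>K. coeff q i * D ^ (K - i))"

lemma cleared_eval_zero [simp]: "cleared_eval D K 0 = 0"
  by (simp add: cleared_eval_def)

lemma cleared_eval_add: "cleared_eval D K (q + q') = cleared_eval D K q + cleared_eval D K q'"
  by (simp add: cleared_eval_def distrib_right sum.distrib)

lemma cleared_eval_smult: "cleared_eval D K (smult c q) = c * cleared_eval D K q"
  by (simp add: cleared_eval_def sum_distrib_left mult_ac)

lemma cleared_eval_pCons:
  "cleared_eval D (Suc K) (pCons c q) = c * D ^ Suc K + cleared_eval D K q"
  unfolding cleared_eval_def by (subst sum.atMost_Suc_shift) simp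

lemma cleared_eval_const: "cleared_eval D K [:c:] = c * D ^ K"
  by (cases K) (simp_all add: cleared_eval_pCons, simp add: cleared_eval_def)

text \<open>
  The polynomials \<open>q\<close> with \<open>q(1/D)\<close> in the localization of \<open>Q\<close> at \<open>D\<close>. Multiplication by the
  polynomial variable is harmless since it only shifts \<open>K\<close> by one; this is why the condition is on
  all large \<open>K\<close> and not on a fixed one.
\<close>

lemma is_ideal_cleared_eval:
  fixes Q :: "'a::comm_ring_1 set"
  assumes Q: "is_ideal Q"
  shows "is_ideal {q. \<exists>K0. \<forall>K\<ge>K0. cleared_eval D K q \<in> Q}" (is "is_ideal ?T")
proof (rule is_idealI)
  show "0 \<in> ?T" by (simp add: Q is_ideal_zero)
  show add: "x + y \<in> ?T" if "x \<in> ?T" "y \<in> ?T" for x y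
  proof -
    from that obtain K1 K2 where "\<forall>K\<ge>K1. cleared_eval D K x \<in> Q" "\<forall>K\<ge>K2. cleared_eval D K y \<in> Q"
      by blast
    then have "\<forall>K\<ge>max K1 K2. cleared_eval D K (x + y) \<in> Q"
      by (simp add: cleared_eval_add is_ideal_add[OF Q])
    then show ?thesis by blast
  qed
  show "c * x \<in> ?T" if x: "x \<in> ?T" for c x
  proof (induction c)
    case 0
    show ?case by (simp add: Q is_ideal_zero)
  next
    case (pCons a c)
    have "smult a x \<in> ?T"
      using x by (auto simp: cleared_eval_smult intro: is_ideal_mult[OF Q])
    moreover have "pCons 0 (c * x) \<in> ?T"
    proof -
      from pCons obtain K0 where K0: "\<forall>K\<ge>K0. cleared_eval D K (c * x) \<in> Q" by blast
      have "\<forall>K\<ge>Suc K0. cleared_eval D K (pCons 0 (c * x)) \<in> Q"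
      proof (intro allI impI)
        fix K assume "Suc K0 \<le> K"
        then obtain K' where "K = Suc K'" "K0 \<le> K'" by (cases K) auto
        with K0 show "cleared_eval D K (pCons 0 (c * x)) \<in> Q"
          by (simp add: cleared_eval_pCons)
      qed
      then show ?thesis by blast
    qed
    ultimately show ?case using add by (simp only: mult_pCons_left)
  qed
qed

section \<open>Minors of a matrix with one additional row\<close>

lemma finite_minors: "finite (minors s (A :: 'i::finite \<Rightarrow> 'j::finite \<Rightarrow> 'a::comm_ring_1))"
proof -
  have "minors s A \<subseteq> (\<lambda>(rs, cs). det (mat s s (\<lambda>(a, b). A (rs ! a) (cs ! b)))) `
      ({rs. set rs \<subseteq> UNIV \<and> length rs = s} \<times> {cs. set cs \<subseteq> UNIV \<and> length cs = s})"
    unfolding minors_def by auto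
  then show ?thesis
    by (rule finite_subset) (intro finite_imageI finite_cartesian_product finite_lists_length_eq finite)
qed

lemma set_eq_UNIV_of_length:
  fixes xs :: "'i::finite list"
  shows "distinct xs \<Longrightarrow> length xs = CARD('i) \<Longrightarrow> set xs = UNIV"
  by (intro card_subset_eq) (simp_all add: distinct_card)

lemma cofactor_cong_row:
  assumes "dim_row A = dim_row B" "dim_col A = dim_col B"
    and "\<And>a b. a < dim_row A \<Longrightarrow> b < dim_col A \<Longrightarrow> a \<noteq> i \<Longrightarrow> A $$ (a, b) = B $$ (a, b)"
  shows "cofactor A i j = cofactor B i j"
proof -
  have "mat_delete A i j = mat_delete B i j"
    by (rule eq_matI) (auto simp: mat_delete_def assms(1,2)[symmetric] intro!: assms(3))
  then show ?thesis by (simp add: cofactor_def)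
qed

lemma cofactor_cong_col:
  assumes "dim_row A = dim_row B" "dim_col A = dim_col B"
    and "\<And>a b. a < dim_row A \<Longrightarrow> b < dim_col A \<Longrightarrow> b \<noteq> j \<Longrightarrow> A $$ (a, b) = B $$ (a, b)"
  shows "cofactor A i j = cofactor B i j"
proof -
  have "mat_delete A i j = mat_delete B i j"
    by (rule eq_matI) (auto simp: mat_delete_def assms(1,2)[symmetric] intro!: assms(3))
  then show ?thesis by (simp add: cofactor_def)
qed

text \<open>
  Expand along the row \<open>d\<close>. Replacing \<open>d\<close> by a row of \<open>J\<close> gives a determinant with two equal rows,
  so \<open>d\<close> may be changed by \<open>\<lambda>J\<close>; what remains is a combination of the entries of \<open>\<lambda>J - d\<close> with the
  cofactors as coefficients.
\<close>

lemma det_in_lagrange_ideal: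
  fixes J :: "'l::finite \<Rightarrow> 'v \<Rightarrow> 'b::comm_ring_1"
  assumes rs: "set rs = UNIV" "length rs = s"
  shows "det (mat s s (\<lambda>(a, b). case_option d J (rs ! a) (cs ! b)))
    \<in> ideal_gen (range (\<lambda>v. (\<Sum>l\<in>UNIV. lam l * J l v) - d v))" (is "det ?A \<in> ?E")
proof -
  have A: "?A \<in> carrier_mat s s" by simp
  obtain i0 where i0: "i0 < s" "rs ! i0 = None"
    using rs by (metis UNIV_I in_set_conv_nth)
  let ?C = "cofactor ?A i0"
  have zero: "(\<Sum>b<s. J l (cs ! b) * ?C b) = 0" for l
  proof -
    obtain k where k: "k < s" "rs ! k = Some l"
      using rs by (metis UNIV_I in_set_conv_nth)
    with i0 have ne: "k \<noteq> i0" by auto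
    let ?B = "mat s s (\<lambda>(a, b). if a = i0 then J l (cs ! b) else ?A $$ (a, b))"
    have "(\<Sum>b<s. J l (cs ! b) * ?C b) = (\<Sum>b<s. ?B $$ (i0, b) * cofactor ?B i0 b)"
      by (intro sum.cong refl arg_cong2[where f = "(*)"] cofactor_cong_row) (use i0 in auto)
    also have "\<dots> = det ?B"
      by (rule laplace_expansion_row[symmetric]) (use i0 in auto)
    also have "\<dots> = 0"
      by (rule det_identical_rows[of _ s k i0]) (use i0 k ne in \<open>auto intro!: eq_vecI\<close>)
    finally show ?thesis .
  qed
  have "det ?A = (\<Sum>b<s. d (cs ! b) * ?C b)"
    by (subst laplace_expansion_row[OF A i0(1)]) (intro sum.cong, use i0 in auto)
  moreover have "(\<Sum>b<s. (\<Sum>l\<in>UNIV. lam l * J l (cs ! b)) * ?C b) = 0"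
  proof -
    have "(\<Sum>b<s. (\<Sum>l\<in>UNIV. lam l * J l (cs ! b)) * ?C b) =
        (\<Sum>l\<in>UNIV. lam l * (\<Sum>b<s. J l (cs ! b) * ?C b))"
      by (subst sum_distrib_right, subst sum.swap) (simp add: sum_distrib_left mult_ac)
    then show ?thesis by (simp add: zero)
  qed
  ultimately have "det ?A =
      (\<Sum>b<s. - ?C b * ((\<Sum>l\<in>UNIV. lam l * J l (cs ! b)) - d (cs ! b)))"
    by (simp add: algebra_simps sum.distrib sum_subtractf)
  also have "\<dots> \<in> ?E"
    by (intro is_ideal_sum is_ideal_gen is_ideal_mult ideal_gen_base) blast
  finally show ?thesis .
qed

text \<open>
  Adjoin to the matrix of \<open>D\<close> the row \<open>d\<close> and, in front, the column \<open>v\<close>. The cofactors along this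
  column involve only the columns of \<open>D\<close>, so they do not depend on \<open>v\<close>; the one in row \<open>d\<close> is \<open>D\<close>,
  and the negatives of the others are the wanted coefficients \<open>a\<close>.
\<close>

lemma minor_times_row_combination:
  fixes J :: "'l::finite \<Rightarrow> 'v \<Rightarrow> 'a::comm_ring_1"
  assumes "D \<in> minors CARD('l) J"
  obtains a where "\<And>v. (\<Sum>l\<in>UNIV. a l * J l v) - D * d v
    \<in> ideal_gen (minors (CARD('l) + 1) (case_option d J))"
proof -
  let ?c = "CARD('l)"
  obtain rs cs where D: "D = det (mat ?c ?c (\<lambda>(a, b). J (rs ! a) (cs ! b)))"
    and rs: "distinct rs" "length rs = ?c" and cs: "distinct cs" "length cs = ?c"
    using assms unfolding minors_def by auto
  have bij: "bij_betw (\<lambda>i. rs ! i) {..<?c} UNIV"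
    using rs set_eq_UNIV_of_length[OF rs] by (metis bij_betw_nth)
  \<comment> \<open>The first column of \<open>B v\<close> is deleted in \<open>C\<close>, so \<open>undefined\<close> stands for any column.\<close>
  define B where "B v = mat (?c + 1) (?c + 1)
    (\<lambda>(i, j). case_option d J ((None # map Some rs) ! i) ((v # cs) ! j))" for v
  define C where "C i = cofactor (B undefined) i 0" for i
  have B: "B v \<in> carrier_mat (?c + 1) (?c + 1)" for v by (simp add: B_def)
  have C: "cofactor (B v) i 0 = C i" for v i
    unfolding C_def by (rule cofactor_cong_col) (auto simp: B_def nth_Cons split: nat.split)
  have C0: "C 0 = D"
  proof -
    have "mat_delete (B undefined) 0 0 = mat ?c ?c (\<lambda>(a, b). J (rs ! a) (cs ! b))"
      by (rule eq_matI) (auto simp: mat_delete_def B_def rs(2))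
    then show ?thesis by (simp add: C_def cofactor_def D)
  qed
  define a where "a l = - C (Suc (inv_into {..<?c} (\<lambda>i. rs ! i) l))" for l
  have "(\<Sum>l\<in>UNIV. a l * J l v) - D * d v = - det (B v)" for v
  proof -
    have "det (B v) = (\<Sum>i<Suc ?c. B v $$ (i, 0) * C i)"
      using laplace_expansion_column[OF B, of 0 v] by (simp add: C)
    also have "\<dots> = d v * D + (\<Sum>i<?c. J (rs ! i) v * C (Suc i))"
      by (subst sum.lessThan_Suc_shift) (simp add: B_def C0 rs(2))
    also have "(\<Sum>i<?c. J (rs ! i) v * C (Suc i)) = - (\<Sum>i<?c. a (rs ! i) * J (rs ! i) v)"
      using bij by (simp add: a_def bij_betw_def inv_into_f_f mult.commute sum_negf)
    also have "(\<Sum>i<?c. a (rs ! i) * J (rs ! i) v) = (\<Sum>l\<in>UNIV. a l * J l v)"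
      by (rule sum.reindex_bij_betw[OF bij])
    finally show ?thesis by (simp add: mult.commute)
  qed
  moreover have "det (B v) \<in> ideal_gen (minors (?c + 1) (case_option d J))" for v
  proof (cases "v \<in> set cs")
    case True
    then obtain k where k: "k < ?c" "cs ! k = v" using cs(2) by (metis in_set_conv_nth)
    have "det (B v) = 0"
      by (rule det_identical_columns[OF B, of 0 "Suc k"])
        (use k in \<open>auto simp: B_def intro!: eq_vecI\<close>)
    then show ?thesis by (simp add: is_ideal_zero is_ideal_gen)
  next
    case False
    have "det (B v) \<in> minors (?c + 1) (case_option d J)"
      unfolding minors_def B_def
      by (rule CollectI, rule exI[of _ "None # map Some rs"], rule exI[of _ "v # cs"])
        (use rs cs False in \<open>auto simp: distinct_map\<close>)
    then show ?thesis by (rule ideal_gen_base)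
  qed
  ultimately show thesis
    by (intro that[of a]) (simp add: is_ideal_neg is_ideal_gen)
qed

section \<open>Elimination of the multipliers over an arbitrary base ring\<close>

lemma saturation_contract_subset:
  assumes hom: "comm_ring_hom \<phi>" and E: "is_ideal E" and sub: "\<phi> ` Q \<subseteq> E"
    and g: "g \<in> saturation Q S"
  shows "\<phi> g \<in> saturation E (ideal_gen (\<phi> ` S))"
proof -
  interpret comm_ring_hom \<phi> by fact
  obtain N where N: "\<And>h. h \<in> ideal_power S N \<Longrightarrow> g * h \<in> Q"
    using g unfolding saturation_def ideal_quotient_def by auto
  have "\<phi> ` ideal_power S N \<subseteq> {x. \<phi> g * x \<in> E}"
    using N sub by (auto simp: hom_mult[symmetric])
  then have "ideal_gen (\<phi> ` ideal_power S N) \<subseteq> {x. \<phi> g * x \<in> E}"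
    by (rule ideal_gen_least[OF _ is_ideal_colon[OF E]])
  then show ?thesis
    using power_extension_subset[OF hom, of S N]
    unfolding saturation_def ideal_quotient_def by blast
qed

text \<open>
  The ring \<open>'b\<close> stands for \<open>R[\<lambda>]\<close>. Its universal property is expressed by the homomorphisms to the
  univariate polynomials over \<open>R\<close> that send each multiplier to a prescribed multiple of the
  variable \<open>s\<close>, which plays the part of \<open>1/D\<close>.
\<close>

theorem eliminate_multipliers:
  fixes J :: "'l::finite \<Rightarrow> 'v::finite \<Rightarrow> 'a::comm_ring_1" and d :: "'v \<Rightarrow> 'a"
    and \<phi> :: "'a \<Rightarrow> 'b::comm_ring_1" and lam :: "'l \<Rightarrow> 'b"
  assumes hom: "comm_ring_hom \<phi>" and I: "is_ideal I"
    and subst: "\<And>a :: 'l \<Rightarrow> 'a. \<exists>\<Psi> :: 'b \<Rightarrow> 'a poly. comm_ring_hom \<Psi> \<and>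
      (\<forall>q. \<Psi> (\<phi> q) = [:q:]) \<and> (\<forall>l. \<Psi> (lam l) = [:0, a l:])"
  defines "M \<equiv> ideal_gen (minors (CARD('l) + 1) (case_option d J))"
    and "S \<equiv> I + ideal_gen (minors CARD('l) J)"
    and "E \<equiv> ideal_gen (\<phi> ` I) +
      ideal_gen (range (\<lambda>v. (\<Sum>l\<in>UNIV. lam l * \<phi> (J l v)) - \<phi> (d v)))"
  shows "saturation (I + M) S = {g. \<phi> g \<in> saturation E (ideal_gen (\<phi> ` S))}"
proof (intro equalityI subsetI CollectI)
  interpret comm_ring_hom \<phi> by fact
  let ?L = "\<lambda>v. (\<Sum>l\<in>UNIV. lam l * \<phi> (J l v)) - \<phi> (d v)"
  have Q: "is_ideal (I + M)"
    unfolding M_def by (intro is_ideal_plus I is_ideal_gen)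
  have IQ: "I \<subseteq> I + M" and MQ: "M \<subseteq> I + M"
    by (auto simp: M_def is_ideal_gen subset_plus_left I subset_plus_right
        intro: subset_plus_left[THEN subsetD] subset_plus_right[THEN subsetD])
  have E: "is_ideal E"
    unfolding E_def by (intro is_ideal_plus is_ideal_gen)
  have LE: "ideal_gen (range ?L) \<subseteq> E" and IE: "ideal_gen (\<phi> ` I) \<subseteq> E"
    unfolding E_def by (auto intro: subset_plus_right[THEN subsetD] subset_plus_left[THEN subsetD] is_ideal_gen)

  \<comment> \<open>The inclusion of the saturations follows from \<open>\<phi> ` (I + M) \<subseteq> E\<close>.\<close>
  have "minors (CARD('l) + 1) (case_option d J) \<subseteq> {x. \<phi> x \<in> E}"
  proof
    fix x assume "x \<in> minors (CARD('l) + 1) (case_option d J)"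
    then obtain rs :: "'l option list" and cs where rs: "distinct rs" "length rs = CARD('l) + 1"
      and x: "x = det (mat (CARD('l) + 1) (CARD('l) + 1) (\<lambda>(a, b). case_option d J (rs ! a) (cs ! b)))"
      unfolding minors_def by blast
    have "set rs = UNIV"
      by (rule set_eq_UNIV_of_length) (use rs in simp_all)
    have "\<phi> x = det (map_mat \<phi> (mat (CARD('l) + 1) (CARD('l) + 1)
        (\<lambda>(a, b). case_option d J (rs ! a) (cs ! b))))"
      unfolding x by (rule hom_det[symmetric])
    also have "map_mat \<phi> (mat (CARD('l) + 1) (CARD('l) + 1)
        (\<lambda>(a, b). case_option d J (rs ! a) (cs ! b))) = mat (CARD('l) + 1) (CARD('l) + 1)
        (\<lambda>(a, b). case_option (\<phi> \<circ> d) (\<lambda>l. \<phi> \<circ> J l) (rs ! a) (cs ! b))"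
      by (rule eq_matI) (auto split: option.split)
    finally have "\<phi> x \<in> ideal_gen (range ?L)"
      using det_in_lagrange_ideal[OF \<open>set rs = UNIV\<close> rs(2), of "\<phi> \<circ> d" "\<lambda>l. \<phi> \<circ> J l" cs lam]
      by simp
    then show "x \<in> {x. \<phi> x \<in> E}" using LE by blast
  qed
  then have "M \<subseteq> {x. \<phi> x \<in> E}"
    unfolding M_def by (intro ideal_gen_least is_ideal_vimage hom E)
  moreover have "I \<subseteq> {x. \<phi> x \<in> E}"
    using IE ideal_gen_base[of _ "\<phi> ` I"] by blast
  ultimately have "I + M \<subseteq> {x. \<phi> x \<in> E}"
    by (intro plus_least is_ideal_vimage hom E)
  then have "\<phi> ` (I + M) \<subseteq> E" by blast
  then show "\<phi> g \<in> saturation E (ideal_gen (\<phi> ` S))" if "g \<in> saturation (I + M) S" for g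
    using saturation_contract_subset[OF hom E] that by blast

  show "g \<in> saturation (I + M) S" if "g \<in> {g. \<phi> g \<in> saturation E (ideal_gen (\<phi> ` S))}" for g
    unfolding S_def mem_saturation_iff[OF Q IQ finite_minors I]
  proof
    fix D assume D: "D \<in> minors CARD('l) J"
    then have "D \<in> S"
      unfolding S_def using subset_plus_right[OF I] ideal_gen_base by blast
    from that obtain N where "\<And>h. h \<in> ideal_power (ideal_gen (\<phi> ` S)) N \<Longrightarrow> \<phi> g * h \<in> E"
      unfolding saturation_def ideal_quotient_def by auto
    from this[OF power_in_ideal_power[OF ideal_gen_base[OF imageI[OF \<open>D \<in> S\<close>]]]]
    have gD: "\<phi> (g * D ^ N) \<in> E" by (simp add: hom_distribs)
    obtain a where a: "\<And>v. (\<Sum>l\<in>UNIV. a l * J l v) - D * d v \<in> M"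
      using minor_times_row_combination[OF D] unfolding M_def by metis
    obtain \<Psi> :: "'b \<Rightarrow> 'a poly" where \<Psi>: "comm_ring_hom \<Psi>"
      and \<Psi>_base: "\<And>q. \<Psi> (\<phi> q) = [:q:]" and \<Psi>_lam: "\<And>l. \<Psi> (lam l) = [:0, a l:]"
      using subst[of a] by blast
    interpret \<Psi>: comm_ring_hom \<Psi> by fact
    \<comment> \<open>\<open>\<Psi>\<close> maps the generators of \<open>E\<close> into the ideal \<open>?T\<close>, hence also \<open>\<phi> (g * D ^ N)\<close>.\<close>
    let ?T = "{q. \<exists>K0. \<forall>K\<ge>K0. cleared_eval D K q \<in> I + M}"
    have T: "is_ideal ?T" by (rule is_ideal_cleared_eval[OF Q])
    have "\<phi> ` I \<subseteq> {x. \<Psi> x \<in> ?T}"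
      using IQ is_ideal_mult_right[OF Q] by (fastforce simp: \<Psi>_base cleared_eval_const)
    moreover have "range ?L \<subseteq> {x. \<Psi> x \<in> ?T}"
    proof clarify
      fix v
      have "\<Psi> (?L v) = (\<Sum>l\<in>UNIV. [:0, a l * J l v:]) - [:d v:]"
        by (simp add: hom_distribs \<Psi>_base \<Psi>_lam mult.commute)
      also have "\<dots> = [:- d v, \<Sum>l\<in>UNIV. a l * J l v:]"
      proof -
        have "(\<Sum>l\<in>X. [:0, a l * J l v:]) = [:0, \<Sum>l\<in>X. a l * J l v:]" if "finite X" for X
          using that by induction auto
        then show ?thesis by simp
      qed
      finally have L: "\<Psi> (?L v) = [:- d v, \<Sum>l\<in>UNIV. a l * J l v:]" .
      have "cleared_eval D (Suc K) (\<Psi> (?L v)) \<in> I + M" for K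
      proof -
        have "cleared_eval D (Suc K) (\<Psi> (?L v)) =
            D ^ K * ((\<Sum>l\<in>UNIV. a l * J l v) - D * d v)"
          by (simp only: L cleared_eval_pCons[of D K] cleared_eval_const) (simp add: algebra_simps)
        then show ?thesis using a MQ is_ideal_mult[OF Q] by (metis subsetD)
      qed
      then have "\<forall>K\<ge>1. cleared_eval D K (\<Psi> (?L v)) \<in> I + M"
        by (metis Suc_le_D One_nat_def)
      then show "\<exists>K0. \<forall>K\<ge>K0. cleared_eval D K (\<Psi> (?L v)) \<in> I + M" by blast
    qed
    ultimately have "E \<subseteq> {x. \<Psi> x \<in> ?T}"
      unfolding E_def
      by (intro plus_least ideal_gen_least is_ideal_vimage[OF \<Psi> T])
    with gD obtain K where "cleared_eval D K [:g * D ^ N:] \<in> I + M"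
      unfolding \<Psi>_base[symmetric] by blast
    then have "g * D ^ (N + K) \<in> I + M"
      by (simp add: cleared_eval_const power_add mult.assoc)
    then show "\<exists>N. g * D ^ N \<in> I + M" ..
  qed
qed

section \<open>Evaluation of multivariate polynomials in an arbitrary ring\<close>

definition monom_eval :: "('v \<Rightarrow> 'a::comm_ring_1) \<Rightarrow> ('v \<Rightarrow>\<^sub>0 nat) \<Rightarrow> 'a" where
  "monom_eval \<sigma> t = (\<Prod>v\<in>Poly_Mapping.keys t. \<sigma> v ^ Poly_Mapping.lookup t v)"

text \<open>
  The universal property of the polynomial ring. Coefficients are mapped by a homomorphism \<open>\<gamma>\<close>
  into the target, so that substitutions into \<open>'w mpoly\<close> and into univariate polynomials over it
  are instances of the same construction.
\<close>

definition mp_eval_hom :: "(complex \<Rightarrow> 'a::comm_ring_1) \<Rightarrow> ('v \<Rightarrow> 'a) \<Rightarrow> 'v mpoly \<Rightarrow> 'a" where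
  "mp_eval_hom \<gamma> \<sigma> q =
     (\<Sum>t\<in>Poly_Mapping.keys q. \<gamma> (Poly_Mapping.lookup q t) * monom_eval \<sigma> t)"

lemma monom_eval_superset:
  assumes "finite X" "Poly_Mapping.keys t \<subseteq> X"
  shows "monom_eval \<sigma> t = (\<Prod>v\<in>X. \<sigma> v ^ Poly_Mapping.lookup t v)"
  unfolding monom_eval_def using assms
  by (intro prod.mono_neutral_left) (auto simp: in_keys_iff)

lemma monom_eval_zero [simp]: "monom_eval \<sigma> 0 = 1"
  by (simp add: monom_eval_def)

lemma monom_eval_add: "monom_eval \<sigma> (s + t) = monom_eval \<sigma> s * monom_eval \<sigma> t"
proof -
  let ?X = "Poly_Mapping.keys s \<union> Poly_Mapping.keys t"
  have "monom_eval \<sigma> (s + t) = (\<Prod>v\<in>?X. \<sigma> v ^ Poly_Mapping.lookup (s + t) v)"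
    by (rule monom_eval_superset) (auto simp: Poly_Mapping.keys_add)
  also have "\<dots> = (\<Prod>v\<in>?X. \<sigma> v ^ Poly_Mapping.lookup s v) * (\<Prod>v\<in>?X. \<sigma> v ^ Poly_Mapping.lookup t v)"
    by (simp add: lookup_add power_add prod.distrib)
  also have "\<dots> = monom_eval \<sigma> s * monom_eval \<sigma> t"
    by (simp add: monom_eval_superset[of ?X])
  finally show ?thesis .
qed

lemma mpoly_induct [case_names zero add_term]:
  fixes q :: "'v mpoly"
  assumes zero: "P 0"
    and add: "\<And>t c q. P q \<Longrightarrow> P (Poly_Mapping.single t c + q)"
  shows "P q"
proof (induction q rule: update_induct)
  case const
  then show ?case by (simp add: zero zero_poly_mapping.abs_eq[symmetric])
next
  case (update q t c)
  have "Poly_Mapping.update t c q = Poly_Mapping.single t c + q"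
    by (rule poly_mapping_eqI)
      (use update in \<open>auto simp: lookup_update lookup_add lookup_single when_def in_keys_iff\<close>)
  then show ?case using add[OF update(3)] by simp
qed

context
  fixes \<gamma> :: "complex \<Rightarrow> 'a::comm_ring_1" and \<sigma> :: "'v \<Rightarrow> 'a"
  assumes \<gamma>: "comm_ring_hom \<gamma>"
begin

interpretation \<gamma>: comm_ring_hom \<gamma> by (rule \<gamma>)

lemma mp_eval_hom_superset:
  assumes "finite X" "Poly_Mapping.keys q \<subseteq> X"
  shows "mp_eval_hom \<gamma> \<sigma> q = (\<Sum>t\<in>X. \<gamma> (Poly_Mapping.lookup q t) * monom_eval \<sigma> t)"
  unfolding mp_eval_hom_def using assms
  by (intro sum.mono_neutral_left) (auto simp: in_keys_iff)

lemma mp_eval_hom_zero: "mp_eval_hom \<gamma> \<sigma> 0 = 0"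
  by (simp add: mp_eval_hom_def)

lemma mp_eval_hom_add: "mp_eval_hom \<gamma> \<sigma> (p + q) = mp_eval_hom \<gamma> \<sigma> p + mp_eval_hom \<gamma> \<sigma> q"
proof -
  let ?X = "Poly_Mapping.keys p \<union> Poly_Mapping.keys q"
  have "mp_eval_hom \<gamma> \<sigma> (p + q) = (\<Sum>t\<in>?X. \<gamma> (Poly_Mapping.lookup (p + q) t) * monom_eval \<sigma> t)"
    by (rule mp_eval_hom_superset) (auto simp: Poly_Mapping.keys_add)
  also have "\<dots> = mp_eval_hom \<gamma> \<sigma> p + mp_eval_hom \<gamma> \<sigma> q"
    by (simp add: mp_eval_hom_superset[of ?X] lookup_add \<gamma>.hom_add distrib_right sum.distrib)
  finally show ?thesis .
qed

lemma mp_eval_hom_single: "mp_eval_hom \<gamma> \<sigma> (Poly_Mapping.single t c) = \<gamma> c * monom_eval \<sigma> t"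
  by (simp add: mp_eval_hom_def)

lemma mp_eval_hom_mult: "mp_eval_hom \<gamma> \<sigma> (p * q) = mp_eval_hom \<gamma> \<sigma> p * mp_eval_hom \<gamma> \<sigma> q"
proof (induction p rule: mpoly_induct)
  case zero
  show ?case by (simp add: mp_eval_hom_zero)
next
  case (add_term t c p)
  have "mp_eval_hom \<gamma> \<sigma> (Poly_Mapping.single t c * q) =
      mp_eval_hom \<gamma> \<sigma> (Poly_Mapping.single t c) * mp_eval_hom \<gamma> \<sigma> q"
  proof (induction q rule: mpoly_induct)
    case zero
    show ?case by (simp add: mp_eval_hom_zero)
  next
    case (add_term u b q)
    then show ?case
      by (simp add: distrib_left mp_eval_hom_add mult_single mp_eval_hom_single
          \<gamma>.hom_mult monom_eval_add mult_ac)
  qed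
  with add_term show ?case by (simp add: distrib_right mp_eval_hom_add)
qed

lemma comm_ring_hom_mp_eval_hom: "comm_ring_hom (mp_eval_hom \<gamma> \<sigma>)"
proof
  show "mp_eval_hom \<gamma> \<sigma> 1 = 1"
    using mp_eval_hom_single[of 0 1] by simp
qed (simp_all add: mp_eval_hom_zero mp_eval_hom_add mp_eval_hom_mult)

lemma mp_eval_hom_Const: "mp_eval_hom \<gamma> \<sigma> (Const c) = \<gamma> c"
  by (simp add: Const_def mp_eval_hom_single)

lemma mp_eval_hom_Var: "mp_eval_hom \<gamma> \<sigma> (Var v) = \<sigma> v"
  by (simp add: Var_def mp_eval_hom_single monom_eval_def)

end

lemma comm_ring_hom_Const: "comm_ring_hom (Const :: complex \<Rightarrow> 'v mpoly)"
  by unfold_locales (simp_all add: Const_def single_add mult_single)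

lemma incl_eq_mp_eval_hom: "incl = mp_eval_hom Const (\<lambda>v. Var (Inl v))"
  by (rule ext) (simp add: incl_def mp_subst_def mp_eval_hom_def monom_eval_def)

lemma comm_ring_hom_incl: "comm_ring_hom (incl :: 'v mpoly \<Rightarrow> ('v + 'l) mpoly)"
  unfolding incl_eq_mp_eval_hom by (rule comm_ring_hom_mp_eval_hom[OF comm_ring_hom_Const])

lemma single_eq_monom_eval: "Poly_Mapping.single t c = Const c * monom_eval Var t"
proof -
  have V: "Var v ^ n = Poly_Mapping.single (Poly_Mapping.single v n) 1" for v :: 'v and n
    by (induction n) (simp_all add: Var_def mult_single single_add[symmetric])
  have "(\<Prod>v\<in>X. Var v ^ Poly_Mapping.lookup t v) =
      Poly_Mapping.single (\<Sum>v\<in>X. Poly_Mapping.single v (Poly_Mapping.lookup t v)) 1"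
    if "finite X" for X
    using that by induction (simp_all add: V mult_single)
  then have "monom_eval Var t =
      Poly_Mapping.single (\<Sum>v\<in>Poly_Mapping.keys t. Poly_Mapping.single v (Poly_Mapping.lookup t v)) 1"
    by (simp add: monom_eval_def)
  also have "(\<Sum>v\<in>Poly_Mapping.keys t. Poly_Mapping.single v (Poly_Mapping.lookup t v)) = t"
    by (rule poly_mapping_eqI)
      (simp add: lookup_sum lookup_single when_def in_keys_iff)
  finally show ?thesis by (simp add: Const_def mult_single)
qed

lemma mpoly_hom_eqI:
  fixes F G :: "'v mpoly \<Rightarrow> 'a::comm_ring_1"
  assumes F: "comm_ring_hom F" and G: "comm_ring_hom G"
    and "\<And>c. F (Const c) = G (Const c)" and "\<And>v. F (Var v) = G (Var v)"
  shows "F q = G q"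
proof -
  interpret F: comm_ring_hom F by fact
  interpret G: comm_ring_hom G by fact
  show ?thesis
    by (induction q rule: mpoly_induct)
      (simp_all add: F.hom_add G.hom_add single_eq_monom_eval F.hom_mult G.hom_mult assms(3,4)
        monom_eval_def F.hom_prod G.hom_prod F.hom_power G.hom_power)
qed

lemma comm_ring_hom_const_poly: "comm_ring_hom (\<lambda>c :: 'a::comm_ring_1. [:c:])"
  by unfold_locales (simp_all add: mult_pCons_left one_pCons)

lemma comm_ring_hom_comp:
  "comm_ring_hom F \<Longrightarrow> comm_ring_hom G \<Longrightarrow> comm_ring_hom (\<lambda>x. G (F x))"
proof -
  assume "comm_ring_hom F" "comm_ring_hom G"
  then interpret F: comm_ring_hom F + G: comm_ring_hom G by simp_all
  show ?thesis by unfold_locales (simp_all add: F.hom_add G.hom_add F.hom_mult G.hom_mult)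
qed

text \<open>
  The substitution \<open>\<lambda> \<mapsto> a s\<close>, where \<open>s\<close> is the variable of the univariate polynomials. Its
  restriction to the base ring is the constant embedding, since both homomorphisms agree on
  constants and variables.
\<close>

lemma exists_multiplier_substitution:
  fixes a :: "'l \<Rightarrow> 'v mpoly"
  shows "\<exists>\<Psi> :: ('v + 'l) mpoly \<Rightarrow> 'v mpoly poly. comm_ring_hom \<Psi> \<and>
    (\<forall>q. \<Psi> (incl q) = [:q:]) \<and> (\<forall>l. \<Psi> (Var (Inr l)) = [:0, a l:])"
proof -
  let ?\<gamma> = "\<lambda>c. [:Const c:] :: 'v mpoly poly"
  let ?\<Psi> = "mp_eval_hom ?\<gamma> (case_sum (\<lambda>v. [:Var v:]) (\<lambda>l. [:0, a l:]))"
  have \<gamma>: "comm_ring_hom ?\<gamma>"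
    by (rule comm_ring_hom_comp[OF comm_ring_hom_Const comm_ring_hom_const_poly])
  have \<Psi>: "comm_ring_hom ?\<Psi>" by (rule comm_ring_hom_mp_eval_hom[OF \<gamma>])
  have "?\<Psi> (incl q) = [:q:]" for q
    by (rule mpoly_hom_eqI[OF comm_ring_hom_comp[OF comm_ring_hom_incl \<Psi>] comm_ring_hom_const_poly])
      (simp_all add: incl_eq_mp_eval_hom mp_eval_hom_Const[OF comm_ring_hom_Const]
        mp_eval_hom_Var[OF comm_ring_hom_Const] mp_eval_hom_Const[OF \<gamma>] mp_eval_hom_Var[OF \<gamma>])
  with \<Psi> show ?thesis by (intro exI[of _ ?\<Psi>]) (simp add: mp_eval_hom_Var[OF \<gamma>])
qed

section \<open>The critical ideal of the incidence variety\<close>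

theorem corollary3p13:
  fixes f :: "'r::finite \<Rightarrow> ('n::finite + 'k::finite) mpoly"
    and p :: "'m::finite \<times> 'n \<Rightarrow> complex"
    and C :: "(('m \<times> 'n) + 'k \<Rightarrow> complex) set"
    and H :: "('m \<times> 'n \<Rightarrow> complex) set"
  assumes "C = incidence_variety f"
    and "H = zariski_closure (proj_x ` C)"
    and "zariski_irreducible C"
    and "dominates proj_x C H"
    and "dominates proj_beta C UNIV"
    and complete_intersection: "zariski_codim C = CARD('m) * CARD('r)"
  shows "critical_ideal f p = eliminate (lagrange_ideal f p)"
proof -
  have codim: "incidence_codim TYPE('m) f = CARD('m \<times> 'r)"
    using assms(1) complete_intersection by (simp add: incidence_codim_def)
  have aug: "augmented_jacobian f p = case_option (distance_vector p) (jacobian f)"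
    by (rule ext) (simp add: augmented_jacobian_def split: option.split)
  have lag: "lagrange_vector f p = (\<lambda>v. (\<Sum>l\<in>UNIV. Var (Inr l) * incl (jacobian f l v)) -
      incl (distance_vector p v))"
    by (rule ext) (simp add: lagrange_vector_def sum.cartesian_product flip: UNIV_Times_UNIV)
  have "saturation (incidence_ideal f +
        ideal_gen (minors (CARD('m \<times> 'r) + 1) (case_option (distance_vector p) (jacobian f))))
      (incidence_ideal f + ideal_gen (minors CARD('m \<times> 'r) (jacobian f))) =
    {g. incl g \<in> saturation (ideal_gen (incl ` incidence_ideal f) +
        ideal_gen (range (\<lambda>v. (\<Sum>l\<in>UNIV. Var (Inr l) * incl (jacobian f l v)) -
          incl (distance_vector p v))))
      (ideal_gen (incl ` (incidence_ideal f + ideal_gen (minors CARD('m \<times> 'r) (jacobian f)))))}"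
    by (rule eliminate_multipliers[OF comm_ring_hom_incl _ exists_multiplier_substitution])
      (simp add: incidence_ideal_def is_ideal_gen)
  then show ?thesis
    unfolding critical_ideal_def lagrange_ideal_def singular_ideal_def eliminate_def
      extend_ideal_def codim aug lag .
qed

end
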